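(* Let $\mathcal{H}$ be a nonzero right quaternionic Hilbert space, let $T \in \mathcal{B}(\mathcal{H})$ and let $\varepsilon>0$. Then the following statements hold: (1) $\Lambda_\varepsilon^S(T)$ is axially symmetric. (2) $\Lambda_{\varepsilon_1}^{S}(T)\subseteq \Lambda_{\varepsilon_2}^{S}(T)$ whenever $0<\varepsilon_1<\varepsilon_2$. (3) $\sigma_S(T)=\bigcap_{\varepsilon>0}\Lambda_{\varepsilon}^{S}(T)$. (4) $\Lambda_{\varepsilon}^{S}(rT)= r\cdot \Lambda_{\varepsilon/r^2}^{S}(T)$ for all $r\in\mathbb{R}\setminus\{0\}$, where $r\cdot X=\{rx: x\in X\}$. (5) If $V\in\mathcal{B}(\mathcal{H})$ is invertible (in $\mathcal{B}(\mathcal{H})$) and $B=V^{-1}TV$, then $\Lambda_{\varepsilon/k}^S(T)\subseteq \Lambda_\varepsilon^S(B)\subseteq \Lambda_{\varepsilon k}^S(T)$, where $k=\|V^{-1}\|\,\|V\|$. (6) $\Lambda_\varepsilon^S(T_1\oplus T_2)=\Lambda_\varepsilon^S(T_1)\cup\Lambda_\varepsilon^S(T_2)$ for all $T_1,T_2\in\mathcal{B}(\mathcal{H})$, where $T_1\oplus T_2$ acts on $\mathcal{H}\oplus\mathcal{H}$. (7) $\Lambda_{\varepsilon}^{S}(T)\subseteq\{q\in\mathbb{H}: |q|\le \|T\|+\sqrt{\varepsilon}\}$. In particular, $\Lambda_\varepsilon^S(T)$ is a non-empty compact subset of $\mathbb{H}$.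
   Context: $\mathbb{H}$ is the division ring of real quaternions; $\mathrm{Re}(q)$ and $|q|$ denote the real part and modulus of $q\in\mathbb{H}$. $\mathbb{S}=\{m\in\mathbb{H}: m^2=-1\}$ is the sphere of imaginary units. For a nonempty $X\subseteq\mathbb{C}=\mathbb{R}+\mathbb{R}i\subset\mathbb{H}$, its circularization is $\Omega_X=\{\alpha+\beta m:\ \alpha,\beta\in\mathbb{R},\ \alpha+\beta i\in X,\ m\in\mathbb{S}\}$; a nonempty $K\subseteq\mathbb{H}$ is axially symmetric if $K=\Omega_X$ for some nonempty $X\subseteq\mathbb{C}$. A right quaternionic Hilbert space is a right $\mathbb{H}$-module with an $\mathbb{H}$-valued inner product (positive definite, right $\mathbb{H}$-linear in the second variable, $\langle x,y\rangle=\overline{\langle y,x\rangle}$), complete in the induced norm. $\mathcal{B}(\mathcal{H})$ is the real Banach algebra of bounded right $\mathbb{H}$-linear operators on $\mathcal{H}$ with the operator norm. For $T\in\mathcal{B}(\mathcal{H})$ and $q\in\mathbb{H}$ put $Q_q(T)=T^2-2\,\mathrm{Re}(q)T+|q|^2I$. The $S$-spectrum is $\sigma_S(T)=\{q\in\mathbb{H}: Q_q(T)\text{ is not invertible in }\mathcal{B}(\mathcal{H})\}$. For $\varepsilon>0$ the pseudo $S$-spectrum is $\Lambda_\varepsilon^S(T)=\sigma_S(T)\cup\{q\in\mathbb{H}\setminus\sigma_S(T): \|Q_q(T)^{-1}\|\ge 1/\varepsilon\}$. *)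

theory Defs
  imports "HOL-Analysis.Analysis"
begin

section \<open>Real quaternions\<close>

datatype quat = Quat (qRe: real) (qIm1: real) (qIm2: real) (qIm3: real)

lemma quat_eq_iff:
  "p = q \<longleftrightarrow> qRe p = qRe q \<and> qIm1 p = qIm1 q \<and> qIm2 p = qIm2 q \<and> qIm3 p = qIm3 q"
  by (cases p; cases q) simp

instantiation quat :: division_ring
begin

definition zero_quat :: quat where "0 = Quat 0 0 0 0"
definition one_quat :: quat where "1 = Quat 1 0 0 0"
definition plus_quat :: "quat \<Rightarrow> quat \<Rightarrow> quat" where
  "p + q = Quat (qRe p + qRe q) (qIm1 p + qIm1 q) (qIm2 p + qIm2 q) (qIm3 p + qIm3 q)"
definition uminus_quat :: "quat \<Rightarrow> quat" where
  "- p = Quat (- qRe p) (- qIm1 p) (- qIm2 p) (- qIm3 p)"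
definition minus_quat :: "quat \<Rightarrow> quat \<Rightarrow> quat" where
  "p - q = Quat (qRe p - qRe q) (qIm1 p - qIm1 q) (qIm2 p - qIm2 q) (qIm3 p - qIm3 q)"
definition times_quat :: "quat \<Rightarrow> quat \<Rightarrow> quat" where
  "p * q = Quat
     (qRe p * qRe q - qIm1 p * qIm1 q - qIm2 p * qIm2 q - qIm3 p * qIm3 q)
     (qRe p * qIm1 q + qIm1 p * qRe q + qIm2 p * qIm3 q - qIm3 p * qIm2 q)
     (qRe p * qIm2 q - qIm1 p * qIm3 q + qIm2 p * qRe q + qIm3 p * qIm1 q)
     (qRe p * qIm3 q + qIm1 p * qIm2 q - qIm2 p * qIm1 q + qIm3 p * qRe q)"
definition inverse_quat :: "quat \<Rightarrow> quat" where
  "inverse p = (let n = (qRe p)\<^sup>2 + (qIm1 p)\<^sup>2 + (qIm2 p)\<^sup>2 + (qIm3 p)\<^sup>2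
     in Quat (qRe p / n) (- qIm1 p / n) (- qIm2 p / n) (- qIm3 p / n))"
definition divide_quat :: "quat \<Rightarrow> quat \<Rightarrow> quat" where
  "p div q = p * inverse (q :: quat)"

lemma quat_sum_squares_nonzero:
  assumes "p \<noteq> (0 :: quat)"
  shows "(qRe p)\<^sup>2 + (qIm1 p)\<^sup>2 + (qIm2 p)\<^sup>2 + (qIm3 p)\<^sup>2 \<noteq> 0"
proof
  assume "(qRe p)\<^sup>2 + (qIm1 p)\<^sup>2 + (qIm2 p)\<^sup>2 + (qIm3 p)\<^sup>2 = 0"
  then have "qRe p = 0 \<and> qIm1 p = 0 \<and> qIm2 p = 0 \<and> qIm3 p = 0"
    by (simp add: add_nonneg_eq_0_iff)
  with assms show False by (simp add: quat_eq_iff zero_quat_def)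
qed

instance
proof
  fix p q r :: quat
  show "p * q * r = p * (q * r)" "(p + q) * r = p * r + q * r" "p * (q + r) = p * q + p * r"
    by (simp_all add: quat_eq_iff times_quat_def plus_quat_def algebra_simps)
  show "p + q + r = p + (q + r)" "p + q = q + p" "0 + p = p" "- p + p = 0" "p - q = p + - q"
    "1 * p = p" "p * 1 = p" "(0 :: quat) \<noteq> 1"
    by (simp_all add: quat_eq_iff zero_quat_def one_quat_def plus_quat_def uminus_quat_def
        minus_quat_def times_quat_def)
  show "inverse p * p = 1" if "p \<noteq> 0"
    using quat_sum_squares_nonzero[OF that]
    by (simp add: quat_eq_iff one_quat_def inverse_quat_def times_quat_def Let_def
        flip: add_divide_distrib diff_divide_distrib)
       (simp add: power2_eq_square mult.commute flip: add_divide_distrib)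
  show "p * inverse p = 1" if "p \<noteq> 0"
    using quat_sum_squares_nonzero[OF that]
    by (simp add: quat_eq_iff one_quat_def inverse_quat_def times_quat_def Let_def
        flip: add_divide_distrib diff_divide_distrib)
       (simp add: power2_eq_square mult.commute flip: add_divide_distrib)
  show "p div q = p * inverse q" by (simp add: divide_quat_def)
  show "inverse (0 :: quat) = 0"
    by (simp add: quat_eq_iff inverse_quat_def zero_quat_def Let_def)
qed

end

instantiation quat :: real_normed_div_algebra
begin

definition scaleR_quat :: "real \<Rightarrow> quat \<Rightarrow> quat" where
  "r *\<^sub>R p = Quat (r * qRe p) (r * qIm1 p) (r * qIm2 p) (r * qIm3 p)"
definition norm_quat :: "quat \<Rightarrow> real" where
  "norm p = sqrt ((qRe p)\<^sup>2 + (qIm1 p)\<^sup>2 + (qIm2 p)\<^sup>2 + (qIm3 p)\<^sup>2)"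
definition sgn_quat :: "quat \<Rightarrow> quat" where "sgn p = inverse (norm p) *\<^sub>R (p :: quat)"
definition dist_quat :: "quat \<Rightarrow> quat \<Rightarrow> real" where "dist p q = norm (p - q :: quat)"
definition uniformity_quat :: "(quat \<times> quat) filter" where
  "uniformity = (INF e\<in>{0 <..}. principal {(p, q :: quat). dist p q < e})"
definition open_quat :: "quat set \<Rightarrow> bool" where
  "open (U :: quat set) \<longleftrightarrow> (\<forall>p\<in>U. eventually (\<lambda>(p', q). p' = p \<longrightarrow> q \<in> U) uniformity)"

lemma norm_quat_eq_norm_prod: "norm p = norm ((qRe p, qIm1 p), (qIm2 p, qIm3 p))"
  by (simp add: norm_quat_def norm_prod_def add.assoc)

instance
proof
  fix p q :: quat and a b :: real
  show "norm (p * q) = norm p * norm q"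
    unfolding norm_quat_def real_sqrt_mult[symmetric]
    by (rule arg_cong[where f = sqrt])
       (simp add: times_quat_def power2_eq_square algebra_simps)
  show "norm (p + q) \<le> norm p + norm q"
    using norm_triangle_ineq[of "((qRe p, qIm1 p), (qIm2 p, qIm3 p))"
        "((qRe q, qIm1 q), (qIm2 q, qIm3 q))"]
    by (simp add: norm_quat_eq_norm_prod plus_quat_def)
  show "norm p = 0 \<longleftrightarrow> p = 0"
    by (simp add: norm_quat_eq_norm_prod quat_eq_iff zero_quat_def zero_prod_def)
  show "norm (a *\<^sub>R p) = \<bar>a\<bar> * norm p"
    using norm_scaleR[of a "((qRe p, qIm1 p), (qIm2 p, qIm3 p))"]
    by (simp add: norm_quat_eq_norm_prod scaleR_quat_def)
  show "a *\<^sub>R (p + q) = a *\<^sub>R p + a *\<^sub>R q" "(a + b) *\<^sub>R p = a *\<^sub>R p + b *\<^sub>R p"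
    "a *\<^sub>R b *\<^sub>R p = (a * b) *\<^sub>R p" "1 *\<^sub>R p = p"
    "a *\<^sub>R p * q = a *\<^sub>R (p * q)" "p * a *\<^sub>R q = a *\<^sub>R (p * q)"
    by (simp_all add: quat_eq_iff scaleR_quat_def plus_quat_def times_quat_def algebra_simps)
qed (simp_all add: sgn_quat_def dist_quat_def uniformity_quat_def open_quat_def)

end

definition qcnj :: "quat \<Rightarrow> quat" where
  "qcnj p = Quat (qRe p) (- qIm1 p) (- qIm2 p) (- qIm3 p)"

definition imag_units :: "quat set" where
  "imag_units = {m. m\<^sup>2 = - 1}"

text \<open>
  Subsets of the complex slice of the quaternions are represented as sets of complex numbers.
\<close>

definition circularization :: "complex set \<Rightarrow> quat set" where
  "circularization X =
     {of_real \<alpha> + of_real \<beta> * m | \<alpha> \<beta> m. Complex \<alpha> \<beta> \<in> X \<and> m \<in> imag_units}"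

definition axially_symmetric :: "quat set \<Rightarrow> bool" where
  "axially_symmetric K \<longleftrightarrow> K \<noteq> {} \<and> (\<exists>X. X \<noteq> {} \<and> K = circularization X)"


section \<open>Right quaternionic Hilbert spaces\<close>

text \<open>
  The real vector space structure is the restriction of the quaternionic one to real scalars, and
  the norm is the one induced by the inner product; completeness comes from \<^class>\<open>banach\<close>.
  That \<open>qinner x x\<close> is real follows from hermitian symmetry.
\<close>

class right_quat_hilbert = banach +
  fixes scaleQ :: "'a \<Rightarrow> quat \<Rightarrow> 'a"  (infixl "\<cdot>\<^sub>Q" 75)
    and qinner :: "'a \<Rightarrow> 'a \<Rightarrow> quat"
  assumes scaleQ_add_left: "(x + y) \<cdot>\<^sub>Q p = x \<cdot>\<^sub>Q p + y \<cdot>\<^sub>Q p"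
    and scaleQ_add_right: "x \<cdot>\<^sub>Q (p + q) = x \<cdot>\<^sub>Q p + x \<cdot>\<^sub>Q q"
    and scaleQ_mult: "x \<cdot>\<^sub>Q (p * q) = (x \<cdot>\<^sub>Q p) \<cdot>\<^sub>Q q"
    and scaleQ_one: "x \<cdot>\<^sub>Q 1 = x"
    and scaleR_eq_scaleQ: "r *\<^sub>R x = x \<cdot>\<^sub>Q of_real r"
    and qinner_add_right: "qinner x (y + z) = qinner x y + qinner x z"
    and qinner_scaleQ_right: "qinner x (y \<cdot>\<^sub>Q p) = qinner x y * p"
    and qinner_commute: "qinner x y = qcnj (qinner y x)"
    and qinner_pos: "x \<noteq> 0 \<Longrightarrow> 0 < qRe (qinner x x)"
    and norm_eq_sqrt_qinner: "norm x = sqrt (qRe (qinner x x))"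

text \<open>
  The Hilbert space direct sum is the product type, whose library norm is the one induced by the
  sum of the two inner products.
\<close>

instantiation prod :: (right_quat_hilbert, right_quat_hilbert) right_quat_hilbert
begin

definition scaleQ_prod :: "'a \<times> 'b \<Rightarrow> quat \<Rightarrow> 'a \<times> 'b" where
  "z \<cdot>\<^sub>Q p = (fst z \<cdot>\<^sub>Q p, snd z \<cdot>\<^sub>Q p)"
definition qinner_prod :: "'a \<times> 'b \<Rightarrow> 'a \<times> 'b \<Rightarrow> quat" where
  "qinner z w = qinner (fst z) (fst w) + qinner (snd z) (snd w)"

instance
proof
  fix x y z :: "'a \<times> 'b" and p q :: quat and r :: real
  show "(x + y) \<cdot>\<^sub>Q p = x \<cdot>\<^sub>Q p + y \<cdot>\<^sub>Q p" "x \<cdot>\<^sub>Q (p + q) = x \<cdot>\<^sub>Q p + x \<cdot>\<^sub>Q q"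
    "x \<cdot>\<^sub>Q (p * q) = (x \<cdot>\<^sub>Q p) \<cdot>\<^sub>Q q" "x \<cdot>\<^sub>Q 1 = x" "r *\<^sub>R x = x \<cdot>\<^sub>Q of_real r"
    by (simp_all add: scaleQ_prod_def scaleQ_add_left scaleQ_add_right scaleQ_mult scaleQ_one
        scaleR_eq_scaleQ prod_eq_iff)
  show "qinner x (y + z) = qinner x y + qinner x z" "qinner x (y \<cdot>\<^sub>Q p) = qinner x y * p"
    by (simp_all add: qinner_prod_def scaleQ_prod_def qinner_add_right qinner_scaleQ_right
        distrib_right)
  show "qinner x y = qcnj (qinner y x)"
    using qinner_commute[of "fst x" "fst y"] qinner_commute[of "snd x" "snd y"]
    by (simp add: qinner_prod_def quat_eq_iff qcnj_def plus_quat_def)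
  have nn: "qRe (qinner u u) = (norm u)\<^sup>2" for u :: "'c :: right_quat_hilbert"
  proof (cases "u = 0")
    case True
    then show ?thesis
      using norm_eq_sqrt_qinner[of u] by simp
  next
    case False
    then show ?thesis
      using qinner_pos[of u] norm_eq_sqrt_qinner[of u] by simp
  qed
  have re: "qRe (qinner x x) = (norm (fst x))\<^sup>2 + (norm (snd x))\<^sup>2"
    by (simp add: qinner_prod_def plus_quat_def nn)
  show "norm x = sqrt (qRe (qinner x x))"
    by (simp add: re norm_prod_def)
  show "0 < qRe (qinner x x)" if "x \<noteq> 0"
    using that by (auto simp: re prod_eq_iff sum_power2_gt_zero_iff)
qed

end


section \<open>Bounded right-linear operators and the pseudo \<open>S\<close>-spectrum\<close>

text \<open>
  \<open>\<B>(\<H>)\<close> is the set of right-linear maps in the Banach space of bounded real-linear operators;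
  the norm there is the operator norm.
\<close>

definition right_linear_ops :: "('a :: right_quat_hilbert \<Rightarrow>\<^sub>L 'a) set" where
  "right_linear_ops = {T. \<forall>x q. blinfun_apply T (x \<cdot>\<^sub>Q q) = blinfun_apply T x \<cdot>\<^sub>Q q}"

definition op_invertible :: "('a :: right_quat_hilbert \<Rightarrow>\<^sub>L 'a) \<Rightarrow> bool" where
  "op_invertible T \<longleftrightarrow> T \<in> right_linear_ops \<and>
     (\<exists>S\<in>right_linear_ops. S o\<^sub>L T = id_blinfun \<and> T o\<^sub>L S = id_blinfun)"

definition op_inverse :: "('a :: right_quat_hilbert \<Rightarrow>\<^sub>L 'a) \<Rightarrow> 'a \<Rightarrow>\<^sub>L 'a" where
  "op_inverse T =
     (THE S. S \<in> right_linear_ops \<and> S o\<^sub>L T = id_blinfun \<and> T o\<^sub>L S = id_blinfun)"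

definition Q_op :: "quat \<Rightarrow> ('a :: right_quat_hilbert \<Rightarrow>\<^sub>L 'a) \<Rightarrow> 'a \<Rightarrow>\<^sub>L 'a" where
  "Q_op q T = (T o\<^sub>L T) - (2 * qRe q) *\<^sub>R T + (norm q)\<^sup>2 *\<^sub>R id_blinfun"

definition S_spectrum :: "('a :: right_quat_hilbert \<Rightarrow>\<^sub>L 'a) \<Rightarrow> quat set" where
  "S_spectrum T = {q. \<not> op_invertible (Q_op q T)}"

definition pseudo_S_spectrum :: "real \<Rightarrow> ('a :: right_quat_hilbert \<Rightarrow>\<^sub>L 'a) \<Rightarrow> quat set" where
  "pseudo_S_spectrum \<epsilon> T =
     S_spectrum T \<union> {q \<in> - S_spectrum T. norm (op_inverse (Q_op q T)) \<ge> 1 / \<epsilon>}"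

lift_definition op_direct_sum ::
  "('a :: right_quat_hilbert \<Rightarrow>\<^sub>L 'a) \<Rightarrow> ('b :: right_quat_hilbert \<Rightarrow>\<^sub>L 'b) \<Rightarrow> ('a \<times> 'b) \<Rightarrow>\<^sub>L ('a \<times> 'b)"
  is "\<lambda>S T z. (S (fst z), T (snd z))"
  by (intro bounded_linear_Pair bounded_linear_compose[OF _ bounded_linear_fst]
      bounded_linear_compose[OF _ bounded_linear_snd])

end

theory Submission
  imports Defs "HOL-Complex_Analysis.Cauchy_Integral_Formula"
begin

text \<open>
  Everything rests on two devices. First, over the real scalars
  \<open>Q\<^sub>q(T)\<close> is the product of the operators \<open>x \<mapsto> x q - T x\<close> and \<open>x \<mapsto> x q\<^sup>* - T x\<close>, so that
  perturbation arguments bound its inverse by \<open>1 / (|q| - \<parallel>T\<parallel>)\<^sup>2\<close> outside the ball of radius \<open>\<parallel>T\<parallel>\<close>.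
  Second, on the slice \<open>\<real> + \<real>i\<close> the inverses of these factors form an entire family
  vanishing at infinity if the \<open>S\<close>-spectrum is empty, which Liouville's theorem excludes.
  Scaling, similarity and direct sums only transform \<open>Q\<^sub>q(T)\<close> and its inverse explicitly.
\<close>


section \<open>Perturbation of invertible operators\<close>

text \<open>Inverses are taken among all bounded real-linear operators, because the factors of
  \<open>Q_op q T\<close> used below are generally not right-linear.\<close>

definition inverse_ops :: "('a :: real_normed_vector \<Rightarrow>\<^sub>L 'a) \<Rightarrow> ('a \<Rightarrow>\<^sub>L 'a) \<Rightarrow> bool" where
  "inverse_ops A B \<longleftrightarrow> (\<forall>x. A (B x) = x) \<and> (\<forall>x. B (A x) = x)"

lemma inverse_opsI:
  fixes A B :: "'a :: real_normed_vector \<Rightarrow>\<^sub>L 'a"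
  assumes "\<And>x. A (B x) = x" "\<And>x. B (A x) = x"
  shows "inverse_ops A B"
  using assms by (simp add: inverse_ops_def)

lemma inverse_opsD:
  fixes A B :: "'a :: real_normed_vector \<Rightarrow>\<^sub>L 'a"
  assumes "inverse_ops A B"
  shows "A (B x) = x" "B (A x) = x"
  using assms by (simp_all add: inverse_ops_def)

lemma inverse_ops_sym: "inverse_ops A B \<Longrightarrow> inverse_ops B A"
  by (simp add: inverse_ops_def)

lemma inverse_ops_iff_compose:
  "inverse_ops A B \<longleftrightarrow> B o\<^sub>L A = id_blinfun \<and> A o\<^sub>L B = id_blinfun"
proof
  assume "inverse_ops A B"
  then show "B o\<^sub>L A = id_blinfun \<and> A o\<^sub>L B = id_blinfun"
    by (auto intro!: blinfun_eqI simp: inverse_ops_def)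
next
  assume "B o\<^sub>L A = id_blinfun \<and> A o\<^sub>L B = id_blinfun"
  then show "inverse_ops A B"
    by (metis inverse_opsI blinfun_apply_blinfun_compose blinfun_apply_id_blinfun id_apply)
qed

lemma inverse_ops_unique:
  assumes "inverse_ops A B" "inverse_ops A C"
  shows "B = C"
  using assms by (metis blinfun_eqI inverse_opsD)

lemma inverse_ops_compose:
  assumes "inverse_ops A B" "inverse_ops C D"
  shows "inverse_ops (A o\<^sub>L C) (D o\<^sub>L B)"
  using assms by (simp add: inverse_ops_def)

text \<open>A left and a right inverse agree, as \<open>C x = C (A (B x)) = B x\<close>.\<close>

lemma inverse_ops_of_one_sided:
  fixes A B C :: "'a :: real_normed_vector \<Rightarrow>\<^sub>L 'a"
  assumes "\<And>x. A (B x) = x" "\<And>x. C (A x) = x"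
  shows "inverse_ops A B"
  by (rule inverse_opsI) (use assms in metis)+

text \<open>The equation for \<open>D\<close> yields
  \<open>norm (D x) \<le> b * norm x + b * norm C * norm (D x)\<close>; the last term has
  coefficient below 1 and is absorbed on the left. Besides perturbed inverses, this later controls
  the resolvent locally.\<close>

lemma norm_le_of_compose_perturbation:
  fixes B C D :: "'a :: real_normed_vector \<Rightarrow>\<^sub>L 'a"
  assumes "norm B \<le> b" "b * norm C < 1" "\<And>x. D x = B x + B (C (D x))"
  shows "norm D \<le> b / (1 - b * norm C)"
proof -
  have b: "0 \<le> b" using assms(1) norm_ge_zero order_trans by blast
  have bnd: "norm (B y) \<le> b * norm y" for y
    using norm_blinfun[of B y] mult_right_mono[OF assms(1) norm_ge_zero] order_trans by blast
  have "norm (D x) \<le> b / (1 - b * norm C) * norm x" for x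
  proof -
    have "norm (D x) \<le> norm (B x) + norm (B (C (D x)))"
      using assms(3)[of x] norm_triangle_ineq by metis
    also have "\<dots> \<le> b * norm x + b * (norm C * norm (D x))"
      using bnd[of x] bnd[of "C (D x)"] mult_left_mono[OF norm_blinfun[of C "D x"] b] by linarith
    finally have "norm (D x) * (1 - b * norm C) \<le> b * norm x"
      by (simp add: algebra_simps)
    then show ?thesis using assms(2) by (simp add: field_simps)
  qed
  then show ?thesis
    using b assms(2) by (intro norm_blinfun_bound) simp_all
qed

text \<open>In place of a Neumann series, \<open>x - A x = y\<close> is solved by the fixed point of
  the contraction \<open>x \<mapsto> y + A x\<close>. Uniqueness of the fixed point makes the
  solution map linear.\<close>

lemma inverse_ops_id_minus:
  fixes A :: "'a :: banach \<Rightarrow>\<^sub>L 'a"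
  assumes "norm A < 1"
  shows "\<exists>B. inverse_ops (id_blinfun - A) B"
proof -
  have ex1: "\<exists>!x. y + A x = x" for y
  proof (rule banach_fix_type)
    show "\<forall>u v. dist (y + A u) (y + A v) \<le> norm A * dist u v"
      using norm_blinfun[of A] by (simp add: dist_norm flip: blinfun.diff_right)
  qed (use assms in auto)
  define g where "g y = (THE x. y + A x = x)" for y
  have g: "y + A (g y) = g y" for y
    unfolding g_def by (rule theI'[OF ex1])
  have gI: "g y = x" if "y + A x = x" for x y
    using ex1[of y] g[of y] that by blast
  have bd: "norm (g y) \<le> norm y * (1 / (1 - norm A))" for y
  proof -
    have "norm (g y) \<le> norm y + norm A * norm (g y)"
      using g[of y] norm_triangle_ineq[of y "A (g y)"] norm_blinfun[of A "g y"] by simp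
    then show ?thesis using assms by (simp add: field_simps)
  qed
  have "bounded_linear g"
  proof (rule bounded_linear_intro)
    show "g (x + y) = g x + g y" for x y
      using arg_cong2[where f = "(+)", OF g[of x] g[of y]]
      by (intro gI) (simp add: blinfun.add_right ac_simps)
    show "g (r *\<^sub>R x) = r *\<^sub>R g x" for r x
      using arg_cong[where f = "scaleR r", OF g[of x]]
      by (intro gI) (simp add: blinfun.scaleR_right scaleR_add_right)
  qed (rule bd)
  then have app: "blinfun_apply (Blinfun g) = g"
    by (rule bounded_linear_Blinfun_apply)
  have "inverse_ops (id_blinfun - A) (Blinfun g)"
  proof (rule inverse_opsI)
    show "(id_blinfun - A) (Blinfun g x) = x" for x
      using g[of x] by (simp add: app blinfun.diff_left diff_eq_eq)
    show "Blinfun g ((id_blinfun - A) x) = x" for x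
      by (simp add: app blinfun.diff_left gI)
  qed
  then show ?thesis ..
qed

lemma inverse_ops_minus:
  fixes A :: "'a :: banach \<Rightarrow>\<^sub>L 'a"
  assumes "inverse_ops A B" "norm B \<le> b" "b * norm C < 1"
  shows "\<exists>D. inverse_ops (A - C) D \<and> norm D \<le> b / (1 - b * norm C)"
proof -
  have "norm (B o\<^sub>L C) \<le> b * norm C"
    using norm_blinfun_compose[of B C] mult_right_mono[OF assms(2) norm_ge_zero] order_trans by blast
  then obtain E where E: "inverse_ops (id_blinfun - (B o\<^sub>L C)) E"
    using inverse_ops_id_minus[of "B o\<^sub>L C"] assms(3) by auto
  \<comment> \<open>Factoring out \<open>A\<close> reduces the claim to a perturbation of the
    identity of norm below 1.\<close>
  have "A - C = A o\<^sub>L (id_blinfun - (B o\<^sub>L C))"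
    using inverse_opsD[OF assms(1)]
    by (intro blinfun_eqI) (simp add: blinfun.diff_left blinfun.diff_right)
  then have inv: "inverse_ops (A - C) (E o\<^sub>L B)"
    using inverse_ops_compose[OF assms(1) E] by simp
  have "(E o\<^sub>L B) x = B x + B (C ((E o\<^sub>L B) x))" for x
    using inverse_opsD(1)[OF E, of "B x"] by (simp add: blinfun.diff_left algebra_simps)
  then have "norm (E o\<^sub>L B) \<le> b / (1 - b * norm C)"
    by (rule norm_le_of_compose_perturbation[OF assms(2,3)])
  with inv show ?thesis by blast
qed


section \<open>Right-linear operators\<close>

lemma right_linear_opsD: "A \<in> right_linear_ops \<Longrightarrow> blinfun_apply A (x \<cdot>\<^sub>Q q) = A x \<cdot>\<^sub>Q q"
  by (simp add: right_linear_ops_def)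

lemma of_real_mult_quat: "of_real r * q = r *\<^sub>R (q :: quat)" "q * of_real r = r *\<^sub>R q"
  by (simp_all add: of_real_def)

lemma scaleR_scaleQ: "(r *\<^sub>R x) \<cdot>\<^sub>Q q = r *\<^sub>R (x \<cdot>\<^sub>Q q)"
  by (simp add: scaleR_eq_scaleQ of_real_mult_quat flip: scaleQ_mult)

lemma scaleQ_diff_left: "(x - y) \<cdot>\<^sub>Q q = x \<cdot>\<^sub>Q q - y \<cdot>\<^sub>Q q"
  by (metis add_diff_cancel diff_add_cancel scaleQ_add_left)

lemma scaleQ_diff_right: "x \<cdot>\<^sub>Q (p - q) = x \<cdot>\<^sub>Q p - x \<cdot>\<^sub>Q q"
  by (metis add_diff_cancel diff_add_cancel scaleQ_add_right)

lemma quat_of_real_eq: "of_real r = Quat r 0 0 0"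
  by (simp add: of_real_def scaleR_quat_def one_quat_def)

lemma qinner_self: "qinner x x = of_real ((norm x)\<^sup>2)"
proof -
  have "0 \<le> qRe (qinner x x)"
    using norm_eq_sqrt_qinner[of x] norm_ge_zero[of x] by simp
  then have "qRe (qinner x x) = (norm x)\<^sup>2"
    by (simp add: norm_eq_sqrt_qinner)
  moreover have "qIm1 (qinner x x) = 0" "qIm2 (qinner x x) = 0" "qIm3 (qinner x x) = 0"
    using qinner_commute[of x x] by (simp_all add: quat_eq_iff qcnj_def)
  ultimately show ?thesis
    by (simp add: quat_eq_iff quat_of_real_eq)
qed

lemma qRe_qinner_self: "qRe (qinner x x) = (norm x)\<^sup>2"
  by (simp add: qinner_self quat_of_real_eq)

lemma qcnj_mult: "qcnj (p * q) = qcnj q * qcnj p"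
  by (simp add: qcnj_def times_quat_def algebra_simps)

lemma qcnj_add: "qcnj (p + q) = qcnj p + qcnj q"
  by (simp add: qcnj_def plus_quat_def)

lemma mult_qcnj: "q * qcnj q = of_real ((norm q)\<^sup>2)" "qcnj q * q = of_real ((norm q)\<^sup>2)"
  by (simp_all add: quat_eq_iff qcnj_def times_quat_def quat_of_real_eq norm_quat_def power2_eq_square)

lemma add_qcnj: "q + qcnj q = of_real (2 * qRe q)"
  by (simp add: quat_eq_iff qcnj_def plus_quat_def quat_of_real_eq)

lemma norm_qcnj: "norm (qcnj q) = norm q"
  by (simp add: qcnj_def norm_quat_def)

lemma qRe_le_norm: "\<bar>qRe q\<bar> \<le> norm q"
  unfolding norm_quat_def by (rule real_le_rsqrt) simp

text \<open>The inner product of \<open>x\<close> with itself is real, hence central, so conjugating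
  it by \<open>q\<close> only multiplies it by the squared modulus of \<open>q\<close>.\<close>

lemma norm_scaleQ: "norm (x \<cdot>\<^sub>Q q) = norm x * norm q"
proof -
  have "qinner (x \<cdot>\<^sub>Q q) (x \<cdot>\<^sub>Q q) = qcnj (qinner x (x \<cdot>\<^sub>Q q)) * q"
    using qinner_commute[of "x \<cdot>\<^sub>Q q" x] by (simp add: qinner_scaleQ_right)
  also have "\<dots> = qcnj q * qinner x x * q"
    using qinner_commute[of x x] by (simp add: qinner_scaleQ_right qcnj_mult)
  also have "\<dots> = (norm x)\<^sup>2 *\<^sub>R of_real ((norm q)\<^sup>2)"
    by (simp only: qinner_self of_real_mult_quat mult_scaleR_left mult_qcnj)
  finally have "(norm (x \<cdot>\<^sub>Q q))\<^sup>2 = (norm x * norm q)\<^sup>2"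
    by (simp add: quat_eq_iff qinner_self quat_of_real_eq scaleR_quat_def power_mult_distrib)
  then show ?thesis by simp
qed

lift_definition right_scale :: "quat \<Rightarrow> 'a :: right_quat_hilbert \<Rightarrow>\<^sub>L 'a" is "\<lambda>q x. x \<cdot>\<^sub>Q q"
  subgoal for q
    by (rule bounded_linear_intro[where K = "norm q"])
      (simp_all add: scaleQ_add_left scaleR_scaleQ norm_scaleQ)
  done

lemma norm_right_scale_le: "norm (right_scale q :: 'a :: right_quat_hilbert \<Rightarrow>\<^sub>L 'a) \<le> norm q"
  by (rule norm_blinfun_bound) (simp_all add: right_scale.rep_eq norm_scaleQ)

lemma inverse_right_scale:
  assumes "q \<noteq> 0"
  shows "inverse_ops (right_scale q) (right_scale (inverse q))"
  using assms by (intro inverse_opsI) (simp_all add: right_scale.rep_eq scaleQ_one flip: scaleQ_mult)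

lemma right_linear_scaleR: "A \<in> right_linear_ops \<Longrightarrow> r *\<^sub>R A \<in> right_linear_ops"
  by (simp add: right_linear_ops_def blinfun.scaleR_left scaleR_scaleQ)

lemma right_linear_compose:
  "A \<in> right_linear_ops \<Longrightarrow> B \<in> right_linear_ops \<Longrightarrow> A o\<^sub>L B \<in> right_linear_ops"
  by (simp add: right_linear_ops_def)

lemma right_linear_Q_op: "T \<in> right_linear_ops \<Longrightarrow> Q_op q T \<in> right_linear_ops"
  by (simp add: right_linear_ops_def Q_op_def blinfun.scaleR_left blinfun.add_left blinfun.diff_left
      scaleR_scaleQ scaleQ_add_left scaleQ_diff_left)

text \<open>Right-linearity of \<open>A\<close> turns \<open>A (B x) \<cdot>\<^sub>Q q\<close> into
  \<open>A (B x \<cdot>\<^sub>Q q)\<close>; applying \<open>B\<close> gives the claim. Hence a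
  right-linear operator invertible as a real-linear one is invertible among right-linear
  operators.\<close>

lemma right_linear_inverse:
  assumes "A \<in> right_linear_ops" "inverse_ops A B"
  shows "B \<in> right_linear_ops"
proof -
  have "B (x \<cdot>\<^sub>Q q) = B x \<cdot>\<^sub>Q q" for x q
    using right_linear_opsD[OF assms(1), of "B x" q] inverse_opsD[OF assms(2)] by metis
  then show ?thesis by (simp add: right_linear_ops_def)
qed

lemma op_invertible_iff: "op_invertible A \<longleftrightarrow> A \<in> right_linear_ops \<and> (\<exists>B. inverse_ops A B)"
  unfolding op_invertible_def inverse_ops_iff_compose[symmetric]
  using right_linear_inverse by blast

lemma op_inverse_eq:
  assumes "A \<in> right_linear_ops" "inverse_ops A B"
  shows "op_inverse A = B"
  unfolding op_inverse_def inverse_ops_iff_compose[symmetric]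
  by (rule the_equality) (use assms in \<open>auto intro: right_linear_inverse inverse_ops_unique\<close>)

lemma not_in_S_spectrum_iff:
  assumes "T \<in> right_linear_ops"
  shows "q \<notin> S_spectrum T \<longleftrightarrow> (\<exists>S. inverse_ops (Q_op q T) S)"
  using right_linear_Q_op[OF assms] by (simp add: S_spectrum_def op_invertible_iff)

text \<open>Passing to the complement merges both cases of the definition into one existential, so
  that most later arguments only have to exhibit an inverse of small norm.\<close>

lemma not_in_pseudo_S_spectrum_iff:
  assumes "T \<in> right_linear_ops"
  shows "q \<notin> pseudo_S_spectrum \<epsilon> T \<longleftrightarrow> (\<exists>S. inverse_ops (Q_op q T) S \<and> norm S < 1 / \<epsilon>)"
proof (cases "q \<in> S_spectrum T")
  case True
  then show ?thesis
    using not_in_S_spectrum_iff[OF assms] by (auto simp: pseudo_S_spectrum_def)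
next
  case False
  then obtain S where S: "inverse_ops (Q_op q T) S"
    using not_in_S_spectrum_iff[OF assms] by blast
  then have "op_inverse (Q_op q T) = S"
    by (rule op_inverse_eq[OF right_linear_Q_op[OF assms]])
  then have "q \<notin> pseudo_S_spectrum \<epsilon> T \<longleftrightarrow> norm S < 1 / \<epsilon>"
    using False by (auto simp: pseudo_S_spectrum_def)
  also have "\<dots> \<longleftrightarrow> (\<exists>S. inverse_ops (Q_op q T) S \<and> norm S < 1 / \<epsilon>)"
    using S inverse_ops_unique by blast
  finally show ?thesis .
qed

text \<open>
  Over the real scalars \<open>Q\<^sub>q(T)\<close> factors as in the complex case, with right multiplication by
  \<open>q\<close> and by its conjugate in place of complex scalars; the factors are not right-linear.
\<close>

lemma Q_op_factor:
  assumes "T \<in> right_linear_ops"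
  shows "Q_op q T = (right_scale q - T) o\<^sub>L (right_scale (qcnj q) - T)"
proof (rule blinfun_eqI)
  fix x
  have "(2 * qRe q) *\<^sub>R T x = T x \<cdot>\<^sub>Q q + T x \<cdot>\<^sub>Q qcnj q"
    using scaleQ_add_right[of "T x" q "qcnj q"] by (simp only: scaleR_eq_scaleQ add_qcnj)
  moreover have "(norm q)\<^sup>2 *\<^sub>R x = x \<cdot>\<^sub>Q qcnj q \<cdot>\<^sub>Q q"
    by (simp only: scaleR_eq_scaleQ mult_qcnj flip: scaleQ_mult)
  ultimately show "Q_op q T x = ((right_scale q - T) o\<^sub>L (right_scale (qcnj q) - T)) x"
    by (simp add: Q_op_def blinfun.bilinear_simps right_scale.rep_eq right_linear_opsD[OF assms]
        scaleQ_diff_left)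
qed

section \<open>Inverses outside the ball of radius \<open>norm T\<close>\<close>

lemma inverse_right_scale_minus:
  fixes T :: "'a :: right_quat_hilbert \<Rightarrow>\<^sub>L 'a"
  assumes "norm T < norm q"
  shows "\<exists>D. inverse_ops (right_scale q - T) D \<and> norm D \<le> 1 / (norm q - norm T)"
proof -
  have q: "0 < norm q" using assms norm_ge_zero[of T] by linarith
  \<comment> \<open>The invertible operator is \<open>right_scale q\<close>, whose inverse has norm
    at most \<open>1 / norm q\<close>, and \<open>T\<close> is the perturbation.\<close>
  have "norm (right_scale (inverse q) :: 'a \<Rightarrow>\<^sub>L 'a) \<le> 1 / norm q"
    using norm_right_scale_le[of "inverse q"] q by (simp add: norm_inverse divide_inverse)
  moreover have "1 / norm q * norm T < 1" using assms q by (simp add: field_simps)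
  moreover have "1 / norm q / (1 - 1 / norm q * norm T) = 1 / (norm q - norm T)"
    using assms q by (simp add: field_simps)
  ultimately show ?thesis
    using inverse_ops_minus[OF inverse_right_scale[of q], of "1 / norm q" T] q by auto
qed

lemma inverse_Q_op_outside_ball:
  assumes "T \<in> right_linear_ops" "norm T < norm q"
  shows "\<exists>S. inverse_ops (Q_op q T) S \<and> norm S \<le> 1 / (norm q - norm T)\<^sup>2"
proof -
  obtain D where D: "inverse_ops (right_scale q - T) D" "norm D \<le> 1 / (norm q - norm T)"
    using inverse_right_scale_minus[OF assms(2)] by blast
  obtain E where E: "inverse_ops (right_scale (qcnj q) - T) E" "norm E \<le> 1 / (norm q - norm T)"
    using inverse_right_scale_minus[of T "qcnj q"] assms(2) by (auto simp: norm_qcnj)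
  have "norm (E o\<^sub>L D) \<le> norm E * norm D" by (rule norm_blinfun_compose)
  also have "\<dots> \<le> 1 / (norm q - norm T) * (1 / (norm q - norm T))"
    using D(2) E(2) assms(2) by (intro mult_mono) auto
  also have "\<dots> = 1 / (norm q - norm T)\<^sup>2" by (simp add: power2_eq_square)
  finally show ?thesis
    using inverse_ops_compose[OF D(1) E(1)] Q_op_factor[OF assms(1), of q] by auto
qed

text \<open>Outside the ball of radius \<open>norm T\<close>, the bound
  \<open>1 / (norm q - norm T)\<^sup>2\<close> drops below \<open>1 / \<epsilon>\<close> as soon as
  \<open>norm q - norm T\<close> exceeds \<open>sqrt \<epsilon>\<close>.\<close>

lemma pseudo_S_spectrum_subset_ball:
  assumes "T \<in> right_linear_ops" "\<epsilon> > 0"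
  shows "pseudo_S_spectrum \<epsilon> T \<subseteq> {q. norm q \<le> norm T + sqrt \<epsilon>}"
proof
  fix q
  assume q: "q \<in> pseudo_S_spectrum \<epsilon> T"
  have "norm q \<le> norm T + sqrt \<epsilon>"
  proof (rule ccontr)
    assume "\<not> norm q \<le> norm T + sqrt \<epsilon>"
    then have gt: "sqrt \<epsilon> < norm q - norm T" by simp
    then have pos: "norm T < norm q" using real_sqrt_gt_zero[OF assms(2)] by linarith
    have "(sqrt \<epsilon>)\<^sup>2 < (norm q - norm T)\<^sup>2"
      using gt assms(2) by (intro power_strict_mono) auto
    then have "1 / (norm q - norm T)\<^sup>2 < 1 / \<epsilon>"
      using assms(2) by (simp add: frac_less2)
    then show False
      using inverse_Q_op_outside_ball[OF assms(1) pos] q not_in_pseudo_S_spectrum_iff[OF assms(1)]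
      by (meson le_less_trans)
  qed
  then show "q \<in> {q. norm q \<le> norm T + sqrt \<epsilon>}" by simp
qed

section \<open>Non-emptiness of the \<open>S\<close>-spectrum\<close>

lemma qinner_diff_right: "qinner x (y - z) = qinner x y - qinner x z"
  by (metis add_diff_cancel diff_add_cancel qinner_add_right)

text \<open>Polarization lets the Cauchy-Schwarz inequality be read off the triangle inequality.\<close>

lemma abs_qRe_qinner_le: "\<bar>qRe (qinner x y)\<bar> \<le> norm x * norm y"
proof -
  have "qinner (x + y) z = qinner x z + qinner y z" for z
    using qinner_commute[of "x + y" z] qinner_commute[of x z] qinner_commute[of y z]
    by (simp add: qinner_add_right qcnj_add)
  moreover have "qRe (qinner y x) = qRe (qinner x y)"
    using qinner_commute[of y x] by (simp add: qcnj_def)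
  ultimately have pol: "(norm (x + y))\<^sup>2 = (norm x)\<^sup>2 + (norm y)\<^sup>2 + 2 * qRe (qinner x y)"
    by (simp add: qinner_add_right plus_quat_def flip: qRe_qinner_self)
  have "(norm (x + y))\<^sup>2 \<le> (norm x + norm y)\<^sup>2"
    by (intro power_mono norm_triangle_ineq) simp
  \<comment> \<open>The reverse triangle inequality supplies the lower bound on the real
    part.\<close>
  moreover have "(norm x - norm y)\<^sup>2 \<le> (norm (x + y))\<^sup>2"
    using norm_triangle_ineq3[of x "- y"] by (simp add: power2_le_iff_abs_le)
  ultimately show ?thesis
    using pol by (simp add: power2_eq_square algebra_simps abs_le_iff)
qed

section \<open>The complex slice and its projection\<close>

definition slice :: "complex \<Rightarrow> quat" where
  "slice z = Quat (Re z) (Im z) 0 0"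

lemma norm_slice: "norm (slice z) = norm z"
  by (simp add: slice_def norm_quat_def cmod_def)

lemma slice_diff: "slice (z - w) = slice z - slice w"
  by (simp add: slice_def minus_quat_def)

lemma slice_mult_commute: "slice z * slice w = slice w * slice z"
  by (simp add: slice_def times_quat_def algebra_simps)

text \<open>The projection onto the first summand of the quaternions written as C + Cj; it is
  complex linear for right multiplication by the slice.\<close>

definition slice_part :: "quat \<Rightarrow> complex" where
  "slice_part p = Complex (qRe p) (qIm1 p)"

lemma slice_part_diff: "slice_part (p - q) = slice_part p - slice_part q"
  by (simp add: slice_part_def minus_quat_def complex_eq_iff)

lemma slice_part_mult: "slice_part (p * slice z) = slice_part p * z"
  by (simp add: slice_part_def slice_def times_quat_def complex_eq_iff algebra_simps)

text \<open>The first imaginary component is a real part in disguise, after scaling \<open>y\<close>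
  by the imaginary unit of the slice. The factor 2 is crude but sufficient for continuity and
  decay.\<close>

lemma norm_slice_part_qinner_le: "norm (slice_part (qinner x y)) \<le> 2 * norm x * norm y"
proof -
  have "qIm1 (qinner x y) = - qRe (qinner x (y \<cdot>\<^sub>Q slice \<i>))"
    by (simp add: qinner_scaleQ_right slice_def times_quat_def)
  then have "\<bar>qIm1 (qinner x y)\<bar> \<le> norm x * norm y"
    using abs_qRe_qinner_le[of x "y \<cdot>\<^sub>Q slice \<i>"] by (simp add: norm_scaleQ norm_slice)
  then show ?thesis
    using abs_qRe_qinner_le[of x y] cmod_le[of "slice_part (qinner x y)"]
    by (simp add: slice_part_def)
qed

lemma Q_op_qcnj: "Q_op (qcnj q) T = Q_op q T"
  by (simp add: Q_op_def norm_qcnj) (simp add: qcnj_def)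

text \<open>\<open>Q_op\<close> does not distinguish \<open>q\<close> from its conjugate, so the two
  factors commute. Each order of the product then gives a one-sided inverse of
  \<open>right_scale q - T\<close>.\<close>

lemma inverse_right_scale_minus_of_not_in_S_spectrum:
  assumes "T \<in> right_linear_ops" "q \<notin> S_spectrum T"
  shows "\<exists>D. inverse_ops (right_scale q - T) D"
proof -
  let ?A = "right_scale q - T" and ?B = "right_scale (qcnj q) - T"
  obtain S where S: "inverse_ops (Q_op q T) S"
    using assms not_in_S_spectrum_iff by blast
  have "qcnj (qcnj q) = q" by (simp add: qcnj_def)
  then have "Q_op q T = ?B o\<^sub>L ?A"
    using Q_op_factor[OF assms(1), of "qcnj q"] by (simp add: Q_op_qcnj)
  then have "inverse_ops ?A (?B o\<^sub>L S)"
    using inverse_opsD[OF S] Q_op_factor[OF assms(1), of q]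
    by (intro inverse_ops_of_one_sided[where C = "S o\<^sub>L ?B"]) (metis blinfun_apply_blinfun_compose)+
  then show ?thesis by blast
qed

text \<open>
  Liouville's theorem applies on the complex slice: there \<open>R z\<close>, the inverse of \<open>x \<mapsto> x z - T x\<close>,
  commutes with right multiplication by slice elements, so the resolvent identity exhibits
  \<open>z \<mapsto> \<langle>y, R z x\<rangle>\<close>, projected to the slice, as an entire function vanishing at infinity.
\<close>

lemma S_spectrum_nonempty:
  fixes T :: "'a :: right_quat_hilbert \<Rightarrow>\<^sub>L 'a"
  assumes "\<exists>x :: 'a. x \<noteq> 0" and T: "T \<in> right_linear_ops"
  shows "S_spectrum T \<noteq> {}"
proof
  assume empty: "S_spectrum T = {}"
  obtain x :: 'a where x: "x \<noteq> 0" using assms(1) ..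
  define A :: "complex \<Rightarrow> 'a \<Rightarrow>\<^sub>L 'a" where "A z = right_scale (slice z) - T" for z
  have "\<forall>z. \<exists>D. inverse_ops (A z) D"
    using inverse_right_scale_minus_of_not_in_S_spectrum[OF T] empty by (simp add: A_def)
  then obtain R where R: "\<And>z. inverse_ops (A z) (R z)" by metis
  have A_comm: "A z (u \<cdot>\<^sub>Q slice w) = A z u \<cdot>\<^sub>Q slice w" for z w u
    by (simp add: A_def blinfun.diff_left right_scale.rep_eq scaleQ_diff_left right_linear_opsD[OF T]
        slice_mult_commute flip: scaleQ_mult)
  have R_comm: "R z (u \<cdot>\<^sub>Q slice w) = R z u \<cdot>\<^sub>Q slice w" for z w u
    using A_comm[of z "R z u" w] inverse_opsD[OF R] by metis
  have resolvent: "R z u = R w u + R w (right_scale (slice (w - z)) (R z u))" for z w u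
  proof -
    have "A w (R z u) = u + R z u \<cdot>\<^sub>Q slice (w - z)"
      using inverse_opsD(1)[OF R, of z u]
      by (simp add: A_def blinfun.diff_left right_scale.rep_eq slice_diff scaleQ_diff_right)
        (simp add: algebra_simps)
    then show ?thesis
      using inverse_opsD(2)[OF R, of w "R z u"] by (simp add: right_scale.rep_eq blinfun.add_right)
  qed
  \<comment> \<open>With this choice \<open>f x 0\<close> is the squared norm of \<open>y\<close>,
    so vanishing of \<open>f x\<close> forces \<open>R 0 x = 0\<close>.\<close>
  define y where "y = R 0 x"
  define f where "f u z = slice_part (qinner y (R z u))" for u z
  \<comment> \<open>The difference quotient of \<open>f u\<close> at \<open>w\<close> is again a
    member of the family, with \<open>u\<close> replaced by \<open>R w u\<close>. Keeping
    \<open>u\<close> variable thus reduces differentiability to continuity.\<close>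
  have f_diff: "f u z - f u w = - f (R w u) z * (z - w)" for u z w
  proof -
    have "R w u - R z u = R z (R w u) \<cdot>\<^sub>Q slice (z - w)"
      using arg_cong[where f = "\<lambda>v. v - R z u", OF resolvent[of w u z]]
      by (simp add: right_scale.rep_eq R_comm)
    then have "f u w - f u z = f (R w u) z * (z - w)"
      by (simp add: f_def qinner_scaleQ_right slice_part_mult flip: slice_part_diff qinner_diff_right)
    then show ?thesis by (simp add: algebra_simps)
  qed
  have f_bound: "norm (f u z) \<le> 2 * norm y * (norm (R z) * norm u)" for u z
    unfolding f_def using norm_slice_part_qinner_le[of y "R z u"] norm_blinfun[of "R z" u]
    by (meson mult_left_mono mult_nonneg_nonneg norm_ge_zero order_trans zero_le_numeral)
  \<comment> \<open>Taking the resolvent identity as a perturbation equation bounds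
    \<open>R z\<close> near \<open>w\<close>, before any continuity of \<open>R\<close> is
    known.\<close>
  have R_local: "norm (R z) \<le> 2 * norm (R w)" if "norm (R w) * norm (z - w) \<le> 1 / 2" for z w
  proof -
    let ?C = "right_scale (slice (w - z)) :: 'a \<Rightarrow>\<^sub>L 'a"
    have "norm (R w) * norm ?C \<le> norm (R w) * norm (z - w)"
      using norm_right_scale_le[of "slice (w - z)"]
      by (intro mult_left_mono) (simp_all add: norm_slice norm_minus_commute)
    then have half: "norm (R w) * norm ?C \<le> 1 / 2" using that by linarith
    have "norm (R z) \<le> norm (R w) / (1 - norm (R w) * norm ?C)"
      by (rule norm_le_of_compose_perturbation[OF order_refl _ resolvent]) (use half in linarith)
    also have "\<dots> \<le> norm (R w) / (1 / 2)"
      using half by (intro divide_left_mono) auto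
    finally show ?thesis by simp
  qed
  have f_cont: "(f u \<longlongrightarrow> f u w) (at w)" for u w
  proof -
    have "((\<lambda>z. norm (R w) * norm (z - w)) \<longlongrightarrow> norm (R w) * norm (w - w)) (at w)"
      by (intro tendsto_intros)
    then have "eventually (\<lambda>z. norm (R w) * norm (z - w) < 1 / 2) (at w)"
      by (rule order_tendstoD) simp
    then have "eventually (\<lambda>z. norm (f u z - f u w) \<le>
        2 * norm y * (2 * norm (R w) * norm (R w u)) * norm (z - w)) (at w)"
    proof eventually_elim
      case (elim z)
      have "norm (f (R w u) z) \<le> 2 * norm y * (2 * norm (R w) * norm (R w u))"
        using f_bound[of "R w u" z] R_local[of w z] elim
        by (smt (verit) mult_left_mono mult_right_mono norm_ge_zero)
      then show ?case
        by (simp add: f_diff norm_mult mult_right_mono)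
    qed
    moreover have "((\<lambda>z. 2 * norm y * (2 * norm (R w) * norm (R w u)) * norm (z - w)) \<longlongrightarrow> 0) (at w)"
      by (rule tendsto_mult_right_zero[OF tendsto_norm_zero[OF LIM_zero[OF tendsto_ident_at]]])
    ultimately have "((\<lambda>z. f u z - f u w) \<longlongrightarrow> 0) (at w)"
      by (rule Lim_null_comparison)
    then show ?thesis by (rule LIM_zero_cancel)
  qed
  have "(f x has_field_derivative - f (R w x) w) (at w)" for w
  proof -
    \<comment> \<open>Continuity of \<open>f (R w x)\<close> at \<open>w\<close> gives the limit of
      the difference quotient.\<close>
    have "eventually (\<lambda>z. - f (R w x) z = (f x z - f x w) / (z - w)) (at w)"
      by (simp add: f_diff eventually_at_filter)
    then show ?thesis
      unfolding has_field_derivative_iff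
      by (rule Lim_transform_eventually[OF tendsto_minus[OF f_cont]])
  qed
  then have "f x holomorphic_on UNIV"
    by (auto simp: holomorphic_on_open)
  moreover have "(f x \<longlongrightarrow> 0) at_infinity"
  proof (rule Lim_null_comparison)
    have "norm (f x z) \<le> 2 * norm y * norm x * (1 / (norm z - norm T))" if "norm T < norm z" for z
    proof -
      obtain D where "inverse_ops (A z) D" "norm D \<le> 1 / (norm z - norm T)"
        using inverse_right_scale_minus[of T "slice z"] \<open>norm T < norm z\<close>
        by (auto simp: norm_slice A_def)
      \<comment> \<open>The inverse obtained by perturbation is \<open>R z\<close> itself, by
        uniqueness of inverses.\<close>
      then have "norm (R z) \<le> 1 / (norm z - norm T)"
        using inverse_ops_unique[OF R] by blast
      then have "2 * norm y * norm x * norm (R z) \<le> 2 * norm y * norm x * (1 / (norm z - norm T))"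
        by (intro mult_left_mono) auto
      then show ?thesis using f_bound[of x z] by (simp add: ac_simps)
    qed
    then show "eventually (\<lambda>z. norm (f x z) \<le> 2 * norm y * norm x * (1 / (norm z - norm T))) at_infinity"
      by (auto simp: eventually_at_infinity intro!: exI[of _ "norm T + 1"])
    have "filterlim (\<lambda>t. t - norm T) at_top at_top"
      using filterlim_tendsto_add_at_top[where f = "\<lambda>_. - norm T", OF tendsto_const filterlim_ident]
      by simp
    then have "((\<lambda>t. 2 * norm y * norm x * (1 / (t - norm T))) \<longlongrightarrow> 0) at_top"
      by (intro tendsto_mult_right_zero tendsto_divide_0[OF tendsto_const] filterlim_at_top_imp_at_infinity)
    then show "((\<lambda>z :: complex. 2 * norm y * norm x * (1 / (norm z - norm T))) \<longlongrightarrow> 0) at_infinity"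
      by (rule filterlim_compose[OF _ filterlim_norm_at_top])
  qed
  ultimately have "f x 0 = 0" by (rule Liouville_weak_0)
  then have "R 0 x = 0"
    by (simp add: f_def y_def slice_part_def qRe_qinner_self complex_eq_iff)
  then show False
    using inverse_opsD(1)[OF R, of 0 x] x by simp
qed


section \<open>Topology and symmetry\<close>

lemma bounded_linear_qRe: "bounded_linear qRe"
  by (rule bounded_linear_intro[where K = 1])
     (simp_all add: plus_quat_def scaleR_quat_def qRe_le_norm)

text \<open>The Heine-Borel property is carried over from real 4-tuples along the linear isometry
  \<open>\<phi>\<close>, which is onto.\<close>

lemma compact_quat:
  fixes K :: "quat set"
  assumes "closed K" "bounded K"
  shows "compact K"
proof -
  define \<phi> :: "(real \<times> real) \<times> (real \<times> real) \<Rightarrow> quat"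
    where "\<phi> v = Quat (fst (fst v)) (snd (fst v)) (fst (snd v)) (snd (snd v))" for v
  have norm: "norm (\<phi> v) = norm v" for v
    by (simp add: norm_quat_eq_norm_prod \<phi>_def)
  have "bounded_linear \<phi>"
    by (rule bounded_linear_intro[where K = 1])
      (simp_all add: norm, simp_all add: \<phi>_def plus_quat_def scaleR_quat_def)
  then have cont: "continuous_on UNIV \<phi>"
    by (rule linear_continuous_on)
  have "closed (\<phi> -` K)"
    using assms(1) cont by (simp add: closed_vimage continuous_on_eq_continuous_within)
  moreover have "bounded (\<phi> -` K)"
    using assms(2) unfolding bounded_iff by (metis norm vimageE)
  ultimately have "compact (\<phi> ` (\<phi> -` K))"
    by (intro compact_continuous_image continuous_on_subset[OF cont]) (auto simp: compact_eq_bounded_closed)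
  moreover have "q \<in> range \<phi>" for q
    by (rule range_eqI[of _ _ "((qRe q, qIm1 q), (qIm2 q, qIm3 q))"]) (simp add: \<phi>_def)
  ultimately show ?thesis
    by (metis UNIV_eq_I surj_image_vimage_eq)
qed

text \<open>\<open>Q_op p T\<close> depends continuously on \<open>p\<close>, and a small
  perturbation keeps the norm of the inverse strictly below \<open>1 / \<epsilon>\<close>; so the
  complement is open.\<close>

lemma closed_pseudo_S_spectrum:
  assumes "T \<in> right_linear_ops"
  shows "closed (pseudo_S_spectrum \<epsilon> T)"
  unfolding closed_def
proof (subst open_subopen, rule ballI)
  fix q assume "q \<in> - pseudo_S_spectrum \<epsilon> T"
  then obtain S where S: "inverse_ops (Q_op q T) S" "norm S < 1 / \<epsilon>"
    using not_in_pseudo_S_spectrum_iff[OF assms] by auto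
  \<comment> \<open>This is the quantity that the perturbation lemma requires to be below 1 when
    passing from \<open>Q_op q T\<close> to \<open>Q_op p T\<close>.\<close>
  define c where "c p = norm S * norm (Q_op q T - Q_op p T)" for p
  have "isCont qRe q" for q
    using bounded_linear_qRe by (rule linear_continuous_at)
  then have "(qRe \<longlongrightarrow> qRe q) (nhds q)"
    by (simp add: continuous_at tendsto_nhds_iff)
  then have "(c \<longlongrightarrow> norm S * norm (Q_op q T - Q_op q T)) (nhds q)"
    unfolding c_def Q_op_def by (intro tendsto_intros filterlim_ident)
  then have c: "(c \<longlongrightarrow> 0) (nhds q)" by simp
  then have "((\<lambda>p. norm S / (1 - c p)) \<longlongrightarrow> norm S / (1 - 0)) (nhds q)"
    by (intro tendsto_intros) auto
  then have "eventually (\<lambda>p. norm S / (1 - c p) < 1 / \<epsilon>) (nhds q)"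
    by (rule order_tendstoD) (use S in simp)
  moreover have "eventually (\<lambda>p. c p < 1) (nhds q)"
    using c by (rule order_tendstoD) simp
  ultimately have "eventually (\<lambda>p. p \<in> - pseudo_S_spectrum \<epsilon> T) (nhds q)"
  proof eventually_elim
    case (elim p)
    then have "\<exists>D. inverse_ops (Q_op q T - (Q_op q T - Q_op p T)) D \<and> norm D \<le> norm S / (1 - c p)"
      unfolding c_def by (intro inverse_ops_minus[OF S(1)]) auto
    then show ?case
      using elim not_in_pseudo_S_spectrum_iff[OF assms] by fastforce
  qed
  then show "\<exists>U. open U \<and> q \<in> U \<and> U \<subseteq> - pseudo_S_spectrum \<epsilon> T"
    by (auto simp: eventually_nhds subset_eq)
qed

text \<open>Real part and modulus of \<open>\<alpha> + \<beta> m\<close> do not depend on the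
  imaginary unit \<open>m\<close>. An invariant set is therefore the circularization of its trace on
  the slice.\<close>

lemma axially_symmetric_of_invariant:
  assumes "K \<noteq> {}"
    and inv: "\<And>p q. p \<in> K \<Longrightarrow> qRe p = qRe q \<Longrightarrow> norm p = norm q \<Longrightarrow> q \<in> K"
  shows "axially_symmetric K"
proof -
  have ReNorm: "qRe (of_real \<alpha> + of_real \<beta> * m) = \<alpha> \<and> norm (of_real \<alpha> + of_real \<beta> * m) = norm (slice (Complex \<alpha> \<beta>))"
    if m: "m \<in> imag_units" for \<alpha> \<beta> m
  proof -
    have sq: "(qRe m)\<^sup>2 - (qIm1 m)\<^sup>2 - (qIm2 m)\<^sup>2 - (qIm3 m)\<^sup>2 = - 1"
      "qRe m * qIm1 m = 0" "qRe m * qIm2 m = 0" "qRe m * qIm3 m = 0"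
      using m by (auto simp: imag_units_def quat_eq_iff power2_eq_square times_quat_def
          one_quat_def uminus_quat_def)
    \<comment> \<open>A nonzero real part would annihilate the imaginary components and leave a real
      square root of -1.\<close>
    have Re: "qRe m = 0"
    proof (rule ccontr)
      assume "qRe m \<noteq> 0"
      then have "(qRe m)\<^sup>2 = - 1" using sq by simp
      then show False by (smt (verit) zero_le_power2)
    qed
    then have im: "(qIm1 m)\<^sup>2 + (qIm2 m)\<^sup>2 + (qIm3 m)\<^sup>2 = 1" using sq(1) by simp
    have "(\<beta> * qIm1 m)\<^sup>2 + (\<beta> * qIm2 m)\<^sup>2 + (\<beta> * qIm3 m)\<^sup>2 = \<beta>\<^sup>2 * ((qIm1 m)\<^sup>2 + (qIm2 m)\<^sup>2 + (qIm3 m)\<^sup>2)"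
      by (simp add: power_mult_distrib algebra_simps)
    then show ?thesis
      using Re im by (simp add: norm_slice cmod_def norm_quat_def plus_quat_def times_quat_def
          slice_def quat_of_real_eq add.assoc)
  qed
  have decomp: "\<exists>\<alpha> \<beta> m. q = of_real \<alpha> + of_real \<beta> * m \<and> m \<in> imag_units" for q
  proof -
    define \<beta> where "\<beta> = sqrt ((qIm1 q)\<^sup>2 + (qIm2 q)\<^sup>2 + (qIm3 q)\<^sup>2)"
    \<comment> \<open>The imaginary part is normalized; for real \<open>q\<close> any imaginary unit
      serves.\<close>
    define m where "m = (if \<beta> = 0 then Quat 0 1 0 0 else Quat 0 (qIm1 q / \<beta>) (qIm2 q / \<beta>) (qIm3 q / \<beta>))"
    have \<beta>2: "\<beta>\<^sup>2 = (qIm1 q)\<^sup>2 + (qIm2 q)\<^sup>2 + (qIm3 q)\<^sup>2"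
      by (simp add: \<beta>_def)
    have "q = of_real (qRe q) + of_real \<beta> * m"
    proof (cases "\<beta> = 0")
      case True
      then have "(qIm1 q)\<^sup>2 + (qIm2 q)\<^sup>2 + (qIm3 q)\<^sup>2 = 0" using \<beta>2 by simp
      then show ?thesis
        using True by (simp add: add_nonneg_eq_0_iff quat_eq_iff m_def times_quat_def plus_quat_def
            quat_of_real_eq)
    next
      case False
      then show ?thesis
        by (simp add: quat_eq_iff m_def times_quat_def plus_quat_def quat_of_real_eq)
    qed
    moreover have "m \<in> imag_units"
    proof (cases "\<beta> = 0")
      case True
      then show ?thesis
        by (simp add: m_def imag_units_def power2_eq_square times_quat_def quat_eq_iff one_quat_def uminus_quat_def)
    next
      case False
      have "(qIm1 q / \<beta>)\<^sup>2 + (qIm2 q / \<beta>)\<^sup>2 + (qIm3 q / \<beta>)\<^sup>2 =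
          ((qIm1 q)\<^sup>2 + (qIm2 q)\<^sup>2 + (qIm3 q)\<^sup>2) / \<beta>\<^sup>2"
        by (simp only: power_divide add_divide_distrib)
      then have "(qIm1 q / \<beta>)\<^sup>2 + (qIm2 q / \<beta>)\<^sup>2 + (qIm3 q / \<beta>)\<^sup>2 = 1"
        using False by (simp flip: \<beta>2)
      then show ?thesis
        using False by (simp add: m_def imag_units_def power2_eq_square times_quat_def quat_eq_iff
            one_quat_def uminus_quat_def)
    qed
    ultimately show ?thesis by blast
  qed
  define X where "X = {z. slice z \<in> K}"
  have iff: "of_real \<alpha> + of_real \<beta> * m \<in> K \<longleftrightarrow> Complex \<alpha> \<beta> \<in> X" if "m \<in> imag_units" for \<alpha> \<beta> m
    using ReNorm[OF that, of \<alpha> \<beta>] inv[of "of_real \<alpha> + of_real \<beta> * m" "slice (Complex \<alpha> \<beta>)"]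
      inv[of "slice (Complex \<alpha> \<beta>)" "of_real \<alpha> + of_real \<beta> * m"]
    by (auto simp: X_def slice_def)
  have "K = circularization X"
  proof (rule set_eqI)
    fix q
    obtain \<alpha> \<beta> m where "q = of_real \<alpha> + of_real \<beta> * m" "m \<in> imag_units"
      using decomp[of q] by blast
    then show "q \<in> K \<longleftrightarrow> q \<in> circularization X"
      unfolding circularization_def using iff by blast
  qed
  moreover from this assms(1) have "X \<noteq> {}"
    by (auto simp: circularization_def)
  ultimately show ?thesis
    using assms(1) unfolding axially_symmetric_def by blast
qed

section \<open>Scaling, similarity and direct sums\<close>

lemma pseudo_S_spectrum_mono:
  assumes "T \<in> right_linear_ops" "0 < \<epsilon>\<^sub>1" "\<epsilon>\<^sub>1 \<le> \<epsilon>\<^sub>2"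
  shows "pseudo_S_spectrum \<epsilon>\<^sub>1 T \<subseteq> pseudo_S_spectrum \<epsilon>\<^sub>2 T"
proof -
  have "1 / \<epsilon>\<^sub>2 \<le> 1 / \<epsilon>\<^sub>1" using assms by (simp add: frac_le)
  then show ?thesis unfolding pseudo_S_spectrum_def by auto
qed

lemma S_spectrum_eq_Inter_pseudo:
  assumes "T \<in> right_linear_ops"
  shows "S_spectrum T = (\<Inter>\<delta>\<in>{0 :: real<..}. pseudo_S_spectrum \<delta> T)"
proof (rule antisym)
  show "S_spectrum T \<subseteq> (\<Inter>\<delta>\<in>{0<..}. pseudo_S_spectrum \<delta> T)"
    by (auto simp: pseudo_S_spectrum_def)
  show "(\<Inter>\<delta>\<in>{0 :: real<..}. pseudo_S_spectrum \<delta> T) \<subseteq> S_spectrum T"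
  proof (rule subsetI, rule ccontr)
    fix q assume q: "q \<in> (\<Inter>\<delta>\<in>{0 :: real<..}. pseudo_S_spectrum \<delta> T)" and "q \<notin> S_spectrum T"
    then obtain S where S: "inverse_ops (Q_op q T) S"
      using not_in_S_spectrum_iff[OF assms] by blast
    \<comment> \<open>Adding 1 makes the inequality with \<open>1 / \<delta>\<close> strict and
      avoids division by zero.\<close>
    define \<delta> where "\<delta> = 1 / (norm S + 1)"
    have "norm S + 1 > 0" using norm_ge_zero[of S] by linarith
    then have "0 < \<delta>" "norm S < 1 / \<delta>" by (simp_all add: \<delta>_def)
    then show False
      using q S not_in_pseudo_S_spectrum_iff[OF assms, of q \<delta>] by auto
  qed
qed

section \<open>Scaling by real numbers\<close>

lemma inverse_ops_scaleR:
  assumes "inverse_ops A B" "c \<noteq> 0"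
  shows "inverse_ops (c *\<^sub>R A) ((1 / c) *\<^sub>R B)"
  using assms by (simp add: inverse_ops_def blinfun.scaleR_left blinfun.scaleR_right)

text \<open>\<open>Q_op\<close> is homogeneous of degree 2 in \<open>q\<close> and \<open>T\<close>
  jointly, which is the source of the rescaled parameter
  \<open>\<epsilon> / r\<^sup>2\<close>.\<close>

lemma Q_op_scaleR: "Q_op (of_real r * q) (r *\<^sub>R T) = r\<^sup>2 *\<^sub>R Q_op q T"
  by (rule blinfun_eqI)
     (simp add: Q_op_def of_real_mult_quat blinfun.bilinear_simps algebra_simps power_mult_distrib,
      simp add: scaleR_quat_def power2_eq_square algebra_simps)

lemma not_in_pseudo_S_spectrum_scaleR:
  assumes "T \<in> right_linear_ops" "r \<noteq> 0" "q \<notin> pseudo_S_spectrum (\<epsilon> / r\<^sup>2) T"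
  shows "of_real r * q \<notin> pseudo_S_spectrum \<epsilon> (r *\<^sub>R T)"
proof -
  obtain S where S: "inverse_ops (Q_op q T) S" "norm S < 1 / (\<epsilon> / r\<^sup>2)"
    using assms not_in_pseudo_S_spectrum_iff by blast
  have "norm ((1 / r\<^sup>2) *\<^sub>R S) < 1 / \<epsilon>"
    using S(2) assms(2) by (simp add: field_simps)
  moreover have "inverse_ops (Q_op (of_real r * q) (r *\<^sub>R T)) ((1 / r\<^sup>2) *\<^sub>R S)"
    unfolding Q_op_scaleR using S(1) assms(2) by (intro inverse_ops_scaleR) auto
  ultimately show ?thesis
    using not_in_pseudo_S_spectrum_iff right_linear_scaleR assms(1) by blast
qed

lemma pseudo_S_spectrum_scaleR:
  assumes T: "T \<in> right_linear_ops" and r: "r \<noteq> 0"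
  shows "pseudo_S_spectrum \<epsilon> (r *\<^sub>R T) = (\<lambda>x. of_real r * x) ` pseudo_S_spectrum (\<epsilon> / r\<^sup>2) T"
proof -
  have cancel: "of_real r * (of_real (1 / r) * q) = q" "of_real (1 / r) * (of_real r * q) = q" for q :: quat
    using r by (simp_all only: of_real_mult_quat scaleR_scaleR) simp_all
  have iff: "of_real r * q \<in> pseudo_S_spectrum \<epsilon> (r *\<^sub>R T) \<longleftrightarrow> q \<in> pseudo_S_spectrum (\<epsilon> / r\<^sup>2) T" for q
  proof
    show "q \<in> pseudo_S_spectrum (\<epsilon> / r\<^sup>2) T" if "of_real r * q \<in> pseudo_S_spectrum \<epsilon> (r *\<^sub>R T)"
      using not_in_pseudo_S_spectrum_scaleR[OF T r] that by blast
    \<comment> \<open>The converse is the same implication applied to \<open>r *\<^sub>R T\<close>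
      and the factor \<open>1 / r\<close>.\<close>
    have "\<epsilon> / r\<^sup>2 / (1 / r)\<^sup>2 = \<epsilon>" "(1 / r) *\<^sub>R r *\<^sub>R T = T"
      using r by (simp_all add: power_divide)
    then show "of_real r * q \<in> pseudo_S_spectrum \<epsilon> (r *\<^sub>R T)" if "q \<in> pseudo_S_spectrum (\<epsilon> / r\<^sup>2) T"
      using not_in_pseudo_S_spectrum_scaleR[OF right_linear_scaleR[OF T], of "1 / r" "of_real r * q" "\<epsilon> / r\<^sup>2" r]
        that r by (metis cancel(2) divide_eq_0_iff one_neq_zero)
  qed
  show ?thesis
  proof (intro antisym subsetI)
    fix x assume "x \<in> pseudo_S_spectrum \<epsilon> (r *\<^sub>R T)"
    then have "of_real (1 / r) * x \<in> pseudo_S_spectrum (\<epsilon> / r\<^sup>2) T"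
      by (simp only: cancel flip: iff)
    then show "x \<in> (\<lambda>x. of_real r * x) ` pseudo_S_spectrum (\<epsilon> / r\<^sup>2) T"
      using cancel(1)[of x] by (metis image_eqI)
  qed (use iff in blast)
qed

section \<open>Similarity\<close>

lemma Q_op_conjugate:
  assumes "inverse_ops V W"
  shows "Q_op q (W o\<^sub>L T o\<^sub>L V) = W o\<^sub>L Q_op q T o\<^sub>L V"
  using inverse_opsD[OF assms] by (intro blinfun_eqI) (simp add: Q_op_def blinfun.bilinear_simps)

text \<open>Conjugation by \<open>V\<close> commutes with forming \<open>Q_op\<close>, so an inverse
  \<open>S\<close> is conjugated too, and its norm grows by at most the factor
  \<open>norm W * norm V\<close>.\<close>

lemma pseudo_S_spectrum_conjugate_subset:
  assumes rl: "T \<in> right_linear_ops" "V \<in> right_linear_ops"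
    and V: "inverse_ops V W" and k: "norm W * norm V > 0"
  shows "pseudo_S_spectrum \<epsilon> (W o\<^sub>L T o\<^sub>L V) \<subseteq> pseudo_S_spectrum (\<epsilon> * (norm W * norm V)) T"
proof (rule subsetI, rule ccontr)
  let ?k = "norm W * norm V"
  have cancel: "1 / (\<epsilon> * c) * c = 1 / \<epsilon>" if "c > 0" for c :: real
    using that by simp
  fix q assume q: "q \<in> pseudo_S_spectrum \<epsilon> (W o\<^sub>L T o\<^sub>L V)" "q \<notin> pseudo_S_spectrum (\<epsilon> * ?k) T"
  then obtain S where S: "inverse_ops (Q_op q T) S" "norm S < 1 / (\<epsilon> * ?k)"
    using not_in_pseudo_S_spectrum_iff[OF rl(1)] by blast
  have "inverse_ops (Q_op q (W o\<^sub>L T o\<^sub>L V)) (W o\<^sub>L (S o\<^sub>L V))"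
    unfolding Q_op_conjugate[OF V]
    by (intro inverse_ops_compose S(1) V inverse_ops_sym[OF V])
  moreover have "norm (W o\<^sub>L (S o\<^sub>L V)) < 1 / \<epsilon>"
  proof -
    have "norm (W o\<^sub>L (S o\<^sub>L V)) \<le> norm W * (norm S * norm V)"
      by (meson norm_blinfun_compose mult_left_mono norm_ge_zero order_trans)
    also have "\<dots> = norm S * ?k" by simp
    also have "\<dots> < 1 / (\<epsilon> * ?k) * ?k" using S(2) k by (intro mult_strict_right_mono)
    also have "\<dots> = 1 / \<epsilon>" by (rule cancel[OF k])
    finally show ?thesis .
  qed
  ultimately have "q \<notin> pseudo_S_spectrum \<epsilon> (W o\<^sub>L T o\<^sub>L V)"
    using not_in_pseudo_S_spectrum_iff right_linear_inverse[OF rl(2) V] rl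
    by (blast intro: right_linear_compose)
  with q(1) show False by blast
qed

lemma pseudo_S_spectrum_similar:
  fixes T V :: "'a :: right_quat_hilbert \<Rightarrow>\<^sub>L 'a"
  assumes nonzero: "\<exists>x :: 'a. x \<noteq> 0" and rl: "T \<in> right_linear_ops" and V: "op_invertible V"
    and B: "B = op_inverse V o\<^sub>L T o\<^sub>L V" and k: "k = norm (op_inverse V) * norm V"
  shows "pseudo_S_spectrum (\<epsilon> / k) T \<subseteq> pseudo_S_spectrum \<epsilon> B"
    and "pseudo_S_spectrum \<epsilon> B \<subseteq> pseudo_S_spectrum (\<epsilon> * k) T"
proof -
  define W where "W = op_inverse V"
  have Vr: "V \<in> right_linear_ops" and VW: "inverse_ops V W"
    using V op_inverse_eq by (auto simp: op_invertible_iff W_def)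
  have Wr: "W \<in> right_linear_ops" by (rule right_linear_inverse[OF Vr VW])
  obtain x :: 'a where "x \<noteq> 0" using nonzero ..
  \<comment> \<open>On the zero space both norms, and hence \<open>k\<close>, would vanish.\<close>
  then have "V \<noteq> 0" "W \<noteq> 0" using inverse_opsD[OF VW, of x] by auto
  then have pos: "norm W * norm V > 0" by simp
  have Br: "B \<in> right_linear_ops"
    unfolding B by (intro right_linear_compose) (use Vr Wr rl in \<open>simp_all add: W_def\<close>)
  \<comment> \<open>Exchanging the roles of \<open>T\<close> and \<open>B\<close>, and of
    \<open>V\<close> and its inverse, yields the first inclusion from the same lemma.\<close>
  have T: "T = V o\<^sub>L B o\<^sub>L W"
    using inverse_opsD[OF VW] by (intro blinfun_eqI) (simp add: B flip: W_def)
  have "norm V * norm W > 0" using pos by (simp add: mult.commute)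
  then have "pseudo_S_spectrum (\<epsilon> / k) T \<subseteq> pseudo_S_spectrum (\<epsilon> / k * (norm V * norm W)) B"
    using pseudo_S_spectrum_conjugate_subset[OF Br Wr inverse_ops_sym[OF VW], of "\<epsilon> / k"]
    by (simp only: flip: T)
  moreover have "\<epsilon> / k * (norm V * norm W) = \<epsilon>"
    using pos by (auto simp: k mult.commute zero_less_mult_iff simp flip: W_def)
  ultimately show "pseudo_S_spectrum (\<epsilon> / k) T \<subseteq> pseudo_S_spectrum \<epsilon> B"
    by simp
  show "pseudo_S_spectrum \<epsilon> B \<subseteq> pseudo_S_spectrum (\<epsilon> * k) T"
    using pseudo_S_spectrum_conjugate_subset[OF rl Vr VW pos] by (simp add: B k W_def)
qed

section \<open>Direct sums\<close>

lemma op_direct_sum_apply: "op_direct_sum A B z = (A (fst z), B (snd z))"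
  by (simp add: op_direct_sum.rep_eq)

lemma Q_op_direct_sum: "Q_op q (op_direct_sum A B) = op_direct_sum (Q_op q A) (Q_op q B)"
  by (rule blinfun_eqI) (simp add: Q_op_def op_direct_sum_apply blinfun.bilinear_simps prod_eq_iff)

lemma right_linear_direct_sum:
  "A \<in> right_linear_ops \<Longrightarrow> B \<in> right_linear_ops \<Longrightarrow> op_direct_sum A B \<in> right_linear_ops"
  by (simp add: right_linear_ops_def op_direct_sum_apply scaleQ_prod_def)

text \<open>The upper bound comes from the Euclidean norm of pairs, the lower one from testing on
  vectors with one zero coordinate. With the maximum, an upper bound on the norm holds exactly when
  it holds for both summands.\<close>

lemma norm_op_direct_sum: "norm (op_direct_sum A B) = max (norm A) (norm B)"
proof (rule antisym)
  let ?m = "max (norm A) (norm B)"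
  have m: "0 \<le> ?m" by (simp add: le_max_iff_disj)
  show "norm (op_direct_sum A B) \<le> ?m"
  proof (rule norm_blinfun_bound[OF m])
    fix z
    have "norm (A u) \<le> ?m * norm u" "norm (B v) \<le> ?m * norm v" for u v
      by (meson norm_blinfun max.cobounded1 max.cobounded2 mult_right_mono norm_ge_zero order_trans)+
    then have "norm (op_direct_sum A B z) \<le> sqrt ((?m * norm (fst z))\<^sup>2 + (?m * norm (snd z))\<^sup>2)"
      unfolding op_direct_sum_apply norm_Pair
      by (intro real_sqrt_le_mono add_mono power_mono) auto
    also have "\<dots> = sqrt (?m\<^sup>2 * ((norm (fst z))\<^sup>2 + (norm (snd z))\<^sup>2))"
      by (simp only: power_mult_distrib distrib_left)
    also have "\<dots> = ?m * norm z"
      using m by (simp add: real_sqrt_mult norm_prod_def)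
    finally show "norm (op_direct_sum A B z) \<le> ?m * norm z" .
  qed
  have "norm (A u) \<le> norm (op_direct_sum A B) * norm u" for u
    using norm_blinfun[of "op_direct_sum A B" "(u, 0)"] by (simp add: op_direct_sum_apply)
  moreover have "norm (B v) \<le> norm (op_direct_sum A B) * norm v" for v
    using norm_blinfun[of "op_direct_sum A B" "(0, v)"] by (simp add: op_direct_sum_apply)
  ultimately show "?m \<le> norm (op_direct_sum A B)"
    by (simp add: norm_blinfun_bound)
qed

lemma inverse_op_direct_sum:
  "inverse_ops A C \<Longrightarrow> inverse_ops B D \<Longrightarrow> inverse_ops (op_direct_sum A B) (op_direct_sum C D)"
  by (simp add: inverse_ops_def op_direct_sum_apply)

text \<open>The diagonal blocks of \<open>W\<close> invert \<open>A\<close> and \<open>B\<close>.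
  Their direct sum is then an inverse as well, so uniqueness shows that \<open>W\<close> has no
  off-diagonal part.\<close>

lemma inverse_op_direct_sumE:
  assumes "inverse_ops (op_direct_sum A B) W"
  obtains C D where "inverse_ops A C" "inverse_ops B D" "W = op_direct_sum C D"
proof -
  have bl: "bounded_linear (\<lambda>x. fst (W (x, 0)))" "bounded_linear (\<lambda>y. snd (W (0, y)))"
    by (auto intro!: bounded_linear_compose[OF bounded_linear_fst] bounded_linear_compose[OF bounded_linear_snd]
        bounded_linear_compose[OF blinfun.bounded_linear_right] bounded_linear_Pair
        bounded_linear_ident bounded_linear_zero)
  have AB: "A (fst (W z)) = fst z" "B (snd (W z)) = snd z" for z
    using inverse_opsD(1)[OF assms, of z] by (simp_all add: op_direct_sum_apply prod_eq_iff)
  have WA: "W (A x, B y) = (x, y)" for x y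
    using inverse_opsD(2)[OF assms, of "(x, y)"] by (simp add: op_direct_sum_apply)
  have "inverse_ops A (Blinfun (\<lambda>x. fst (W (x, 0))))"
    using AB(1)[of "(_, 0)"] WA[of _ 0]
    by (intro inverse_opsI) (simp_all add: bounded_linear_Blinfun_apply[OF bl(1)])
  moreover have "inverse_ops B (Blinfun (\<lambda>y. snd (W (0, y))))"
    using AB(2)[of "(0, _)"] WA[of 0]
    by (intro inverse_opsI) (simp_all add: bounded_linear_Blinfun_apply[OF bl(2)])
  ultimately show ?thesis
    using that inverse_ops_unique[OF assms inverse_op_direct_sum] by blast
qed

lemma pseudo_S_spectrum_direct_sum:
  assumes "A \<in> right_linear_ops" "B \<in> right_linear_ops"
  shows "pseudo_S_spectrum \<epsilon> (op_direct_sum A B) = pseudo_S_spectrum \<epsilon> A \<union> pseudo_S_spectrum \<epsilon> B"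
proof -
  have "q \<notin> pseudo_S_spectrum \<epsilon> (op_direct_sum A B) \<longleftrightarrow>
      q \<notin> pseudo_S_spectrum \<epsilon> A \<and> q \<notin> pseudo_S_spectrum \<epsilon> B" (is "?L \<longleftrightarrow> ?R") for q
  proof
    assume ?L
    then obtain W where W: "inverse_ops (op_direct_sum (Q_op q A) (Q_op q B)) W" "norm W < 1 / \<epsilon>"
      using not_in_pseudo_S_spectrum_iff[OF right_linear_direct_sum[OF assms]]
      by (auto simp: Q_op_direct_sum)
    from W(1) obtain C D where "inverse_ops (Q_op q A) C" "inverse_ops (Q_op q B) D" "W = op_direct_sum C D"
      by (rule inverse_op_direct_sumE)
    then show ?R
      using W(2) assms by (auto simp: not_in_pseudo_S_spectrum_iff norm_op_direct_sum)
  next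
    assume ?R
    then obtain C D where "inverse_ops (Q_op q A) C" "norm C < 1 / \<epsilon>"
        "inverse_ops (Q_op q B) D" "norm D < 1 / \<epsilon>"
      using assms by (auto simp: not_in_pseudo_S_spectrum_iff)
    then show ?L
      using not_in_pseudo_S_spectrum_iff[OF right_linear_direct_sum[OF assms], of q \<epsilon>]
        inverse_op_direct_sum[of "Q_op q A" C "Q_op q B" D]
      by (auto simp: Q_op_direct_sum norm_op_direct_sum)
  qed
  then show ?thesis by blast
qed

theorem proposition3p2:
  fixes T :: "'a :: right_quat_hilbert \<Rightarrow>\<^sub>L 'a" and \<epsilon> :: real
  assumes nonzero: "\<exists>x :: 'a. x \<noteq> 0"
    and T: "T \<in> right_linear_ops"
    and \<epsilon>: "\<epsilon> > 0"
  shows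
    "axially_symmetric (pseudo_S_spectrum \<epsilon> T) \<and>
     (\<forall>(\<epsilon>1 :: real) (\<epsilon>2 :: real). 0 < \<epsilon>1 \<and> \<epsilon>1 < \<epsilon>2 \<longrightarrow> pseudo_S_spectrum \<epsilon>1 T \<subseteq> pseudo_S_spectrum \<epsilon>2 T) \<and>
     S_spectrum T = (\<Inter>\<delta>\<in>{0 :: real<..}. pseudo_S_spectrum \<delta> T) \<and>
     (\<forall>r :: real. r \<noteq> 0 \<longrightarrow>
        pseudo_S_spectrum \<epsilon> (r *\<^sub>R T) = (\<lambda>x. of_real r * x) ` pseudo_S_spectrum (\<epsilon> / r\<^sup>2) T) \<and>
     (\<forall>(V :: 'a \<Rightarrow>\<^sub>L 'a) (B :: 'a \<Rightarrow>\<^sub>L 'a) (k :: real).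
        op_invertible V \<and> B = op_inverse V o\<^sub>L T o\<^sub>L V \<and> k = norm (op_inverse V) * norm V \<longrightarrow>
        pseudo_S_spectrum (\<epsilon> / k) T \<subseteq> pseudo_S_spectrum \<epsilon> B \<and>
        pseudo_S_spectrum \<epsilon> B \<subseteq> pseudo_S_spectrum (\<epsilon> * k) T) \<and>
     (\<forall>(T1 :: 'a \<Rightarrow>\<^sub>L 'a) (T2 :: 'a \<Rightarrow>\<^sub>L 'a). T1 \<in> right_linear_ops \<and> T2 \<in> right_linear_ops \<longrightarrow>
        pseudo_S_spectrum \<epsilon> (op_direct_sum T1 T2) =
          pseudo_S_spectrum \<epsilon> T1 \<union> pseudo_S_spectrum \<epsilon> T2) \<and>
     pseudo_S_spectrum \<epsilon> T \<subseteq> {q. norm q \<le> norm T + sqrt \<epsilon>} \<and>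
     pseudo_S_spectrum \<epsilon> T \<noteq> {} \<and> compact (pseudo_S_spectrum \<epsilon> T)"
proof -
  have ne: "pseudo_S_spectrum \<epsilon> T \<noteq> {}"
    using S_spectrum_nonempty[OF nonzero T] by (auto simp: pseudo_S_spectrum_def)
  have ball: "pseudo_S_spectrum \<epsilon> T \<subseteq> {q. norm q \<le> norm T + sqrt \<epsilon>}"
    by (rule pseudo_S_spectrum_subset_ball[OF T \<epsilon>])
  \<comment> \<open>\<open>Q_op q T\<close> involves \<open>q\<close> only through its real part and
    modulus.\<close>
  have sym: "axially_symmetric (pseudo_S_spectrum \<epsilon> T)"
  proof (rule axially_symmetric_of_invariant[OF ne])
    show "q \<in> pseudo_S_spectrum \<epsilon> T"
      if "p \<in> pseudo_S_spectrum \<epsilon> T" "qRe p = qRe q" "norm p = norm q" for p q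
      using that by (simp add: pseudo_S_spectrum_def S_spectrum_def Q_op_def)
  qed
  have compact: "compact (pseudo_S_spectrum \<epsilon> T)"
    using ball by (intro compact_quat closed_pseudo_S_spectrum[OF T]) (auto simp: bounded_iff)
  have mono: "pseudo_S_spectrum \<epsilon>1 T \<subseteq> pseudo_S_spectrum \<epsilon>2 T" if "0 < \<epsilon>1 \<and> \<epsilon>1 < \<epsilon>2" for \<epsilon>1 \<epsilon>2
    by (rule pseudo_S_spectrum_mono[OF T]) (use that in auto)
  have similar: "pseudo_S_spectrum (\<epsilon> / k) T \<subseteq> pseudo_S_spectrum \<epsilon> B"
      "pseudo_S_spectrum \<epsilon> B \<subseteq> pseudo_S_spectrum (\<epsilon> * k) T"
    if "op_invertible V \<and> B = op_inverse V o\<^sub>L T o\<^sub>L V \<and> k = norm (op_inverse V) * norm V" for V B k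
    using pseudo_S_spectrum_similar[OF nonzero T] that by simp_all
  have direct_sum: "pseudo_S_spectrum \<epsilon> (op_direct_sum T1 T2) = pseudo_S_spectrum \<epsilon> T1 \<union> pseudo_S_spectrum \<epsilon> T2"
    if "T1 \<in> right_linear_ops \<and> T2 \<in> right_linear_ops" for T1 T2 :: "'a \<Rightarrow>\<^sub>L 'a"
    by (rule pseudo_S_spectrum_direct_sum) (use that in simp_all)
  show ?thesis
    by (intro conjI allI impI)
       (rule sym mono S_spectrum_eq_Inter_pseudo[OF T] pseudo_S_spectrum_scaleR[OF T] similar direct_sum
          ball ne compact; assumption?)+
qed

end
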